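(* For each $s \in (0,1]$, the set $\mathcal{D}^{(s)}_{\mathrm{div}} = \{ x \in [0,1] : \sum_{n \in \mathbb{N}} 1/(d_n(x))^{s} \text{ diverges} \}$ has box-counting dimension $1$.
   Context: Pierce digits. For $x \in [0,1]$, define $d_1(x) := \lfloor 1/x \rfloor$ and $T(x) := 1 - d_1(x)\,x$ if $x \neq 0$, and $d_1(0) := \infty$, $T(0) := 0$. Here $\lfloor y \rfloor$ is the largest integer not exceeding $y$. For $n \in \mathbb{N} = \{1,2,3,\dots\}$ put $d_n(x) := d_1(T^{n-1}(x))$, where $T^{n-1}$ is the $(n-1)$-fold iterate of $T$ ($T^0$ is the identity). The sequence $(d_n(x))_{n \in \mathbb{N}}$ is the Pierce expansion digit sequence of $x$. Conventions: $\infty^s := \infty$ for $s>0$ and $c/\infty := 0$ for $c \in \mathbb{R}$. The box-counting dimension of a non-empty set $F \subseteq [0,1]$ is $\lim_{\delta \to 0} \frac{\log N_\delta(F)}{-\log \delta}$, provided the limit exists, where $N_\delta(F)$ is the smallest number of sets of diameter not exceeding $\delta$ that cover $F$. *)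

theory Defs
  imports "HOL-Analysis.Analysis"
begin

definition pierce_d1 :: "real \<Rightarrow> enat" where
  "pierce_d1 x = (if x = 0 then \<infinity> else enat (nat \<lfloor>1 / x\<rfloor>))"

definition pierce_T :: "real \<Rightarrow> real" where
  "pierce_T x = (if x = 0 then 0 else 1 - of_int \<lfloor>1 / x\<rfloor> * x)"

(* Meaningful for n \<ge> 1 only: the digits are indexed from 1. *)
definition pierce_digit :: "nat \<Rightarrow> real \<Rightarrow> enat" where
  "pierce_digit n x = pierce_d1 ((pierce_T ^^ (n - 1)) x)"

(* Real powers of extended digits, used for s > 0 only, whence the value \<infinity> at \<infinity>. *)
definition digit_powr :: "enat \<Rightarrow> real \<Rightarrow> ereal" where
  "digit_powr d s = (case d of enat k \<Rightarrow> ereal (real k powr s) | \<infinity> \<Rightarrow> \<infinity>)"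

(* In ereal, 1 / \<infinity> = 0.  The digits of x \<in> [0,1] are at least 1, so every term is a finite
   real and real_of_ereal loses nothing.  The shift by Suc makes the sum range over n \<ge> 1. *)
definition D_div :: "real \<Rightarrow> real set" where
  "D_div s = {x \<in> {0..1}.
     \<not> summable (\<lambda>n. real_of_ereal (1 / digit_powr (pierce_digit (Suc n) x) s))}"

(* The library's diameter is a junk value on unbounded sets, hence the explicit boundedness. *)
definition is_diam_cover :: "real \<Rightarrow> real set \<Rightarrow> real set set \<Rightarrow> bool" where
  "is_diam_cover \<delta> F \<U> \<longleftrightarrow>
     finite \<U> \<and> F \<subseteq> \<Union>\<U> \<and> (\<forall>U\<in>\<U>. bounded U \<and> diameter U \<le> \<delta>)"

(* For bounded F and \<delta> > 0 a finite cover exists, so the minimum is attained. *)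
definition covering_number :: "real \<Rightarrow> real set \<Rightarrow> nat" where
  "covering_number \<delta> F = (LEAST k. \<exists>\<U>. is_diam_cover \<delta> F \<U> \<and> card \<U> = k)"

(* A relation, since the defining limit need not exist. *)
definition has_box_dimension :: "real set \<Rightarrow> real \<Rightarrow> bool" where
  "has_box_dimension F D \<longleftrightarrow>
     F \<noteq> {} \<and> F \<subseteq> {0..1} \<and>
     ((\<lambda>\<delta>. ln (real (covering_number \<delta> F)) / (- ln \<delta>)) \<longlongrightarrow> D) (at_right 0)"

end

theory Submission
  imports Defs "HOL-Real_Asymp.Real_Asymp"
begin

text \<open>
  The covering numbers of a set are, up to a constant factor, those of its closure: if finitely many
  sets of diameter at most \<open>\<delta>\<close> cover a dense subset of \<open>[0,1]\<close>, the closed balls of radius \<open>\<delta>\<close>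
  about one point of each cover all of \<open>[0,1]\<close>, so their number is at least \<open>1 / (2 * \<delta>)\<close>.
  Every dense subset of \<open>[0,1]\<close> therefore has box dimension \<open>1\<close> (\<open>has_box_dimension_dense\<close>),
  and it remains to see that the divergence set is dense (\<open>closure_D_div\<close>).

  The divergence set contains the points \<open>y k\<close> with digits \<open>k, k + 1, k + 2, \<dots>\<close>, since for \<open>s \<le> 1\<close>
  the sum of the \<open>1 / (k + n) powr s\<close> dominates a tail of the harmonic series. Moreover the set
  contains a point as soon as it contains its image under the Pierce map \<open>T\<close>, because the digits of
  \<open>T x\<close> are those of \<open>x\<close> without the first. As \<open>y m\<close> tends to \<open>0\<close>, the points \<open>(1 - y m) / k\<close>
  for \<open>m > k\<close>, with digits \<open>k, m, m + 1, \<dots>\<close>, lie in the set and approach \<open>1 / k\<close> from below.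

  Suppose an interval \<open>(a, b)\<close> misses the set. By the previous remark no \<open>1 / k\<close> lies in \<open>(a, b]\<close>,
  so the interval lies in a single branch of \<open>T\<close>, where \<open>T\<close> is affine with slope \<open>- k\<close>. Its image
  is an interval inside \<open>[0, 1 / (k + 1)]\<close>, hence inside \<open>[0, 1/2]\<close>, that again misses the set
  (\<open>D_div_gap_expands\<close>). On \<open>(0, 1/2]\<close> all slopes are at least \<open>2\<close> in absolute value, so iteration
  doubles the length of the gap at every step, which is impossible inside \<open>[0, 1/2]\<close>.
\<close>

section \<open>Points whose digits are consecutive integers\<close>

text \<open>The Pierce expansion with digits \<open>d\<^sub>1, d\<^sub>2, \<dots>\<close> represents the alternating series with terms
  \<open>1 / (d\<^sub>1 * \<dots> * d\<^sub>n)\<close>. For the digits \<open>k, k + 1, \<dots>\<close> these products are Pochhammer symbols.\<close>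

definition consecutive_pierce :: "nat \<Rightarrow> real" where
  "consecutive_pierce k = (\<Sum>j. (-1) ^ j * (1 / pochhammer (real k) (Suc j)))"

lemma Suc_le_pochhammer:
  assumes "1 \<le> k"
  shows "real (Suc j) \<le> pochhammer (real k) (Suc j)"
proof (induction j)
  case 0
  then show ?case using assms by simp
next
  case (Suc j)
  have "real (Suc (Suc j)) \<le> real k + real (Suc j)"
    using assms by simp
  also have "\<dots> = 1 * (real k + real (Suc j))" by simp
  also have "\<dots> \<le> pochhammer (real k) (Suc j) * (real k + real (Suc j))"
    using Suc by (intro mult_right_mono) simp_all
  also have "\<dots> = pochhammer (real k) (Suc (Suc j))"
    by (simp only: pochhammer_Suc)
  finally show ?case .
qed

lemma
  assumes "1 \<le> k"
  shows summable_consecutive_pierce: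
      "summable (\<lambda>j. (-1) ^ j * (1 / pochhammer (real k) (Suc j)))"
    and consecutive_pierce_nonneg: "0 \<le> consecutive_pierce k"
proof -
  let ?a = "\<lambda>j. 1 / pochhammer (real k) (Suc j)"
  have pos: "0 < pochhammer (real k) (Suc j)" for j
    using assms by (intro pochhammer_pos) simp
  have lim: "?a \<longlonglongrightarrow> 0"
  proof (rule tendsto_sandwich)
    show "\<forall>\<^sub>F j in sequentially. ?a j \<le> 1 / real (Suc j)"
      using Suc_le_pochhammer[OF assms] pos
      by (intro always_eventually allI frac_le) simp_all
    show "\<forall>\<^sub>F j in sequentially. 0 \<le> ?a j"
      using pos by (intro always_eventually allI) (simp add: less_imp_le)
    show "(\<lambda>j. 1 / real (Suc j)) \<longlonglongrightarrow> 0" by real_asymp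
  qed simp
  have mono: "?a (Suc j) \<le> ?a j" for j
  proof (rule frac_le)
    have "pochhammer (real k) (Suc j) * 1 \<le> pochhammer (real k) (Suc j) * (real k + real (Suc j))"
      using pos[of j] assms by (intro mult_left_mono) simp_all
    then show "pochhammer (real k) (Suc j) \<le> pochhammer (real k) (Suc (Suc j))"
      by (simp only: pochhammer_Suc mult_1_right)
  qed (use pos in simp_all)
  have nonneg: "0 \<le> ?a j" for j
    using pos[of j] by simp
  show "summable (\<lambda>j. (-1) ^ j * ?a j)"
    by (rule summable_Leibniz'(1)[OF lim nonneg mono])
  show "0 \<le> consecutive_pierce k"
    using summable_Leibniz'(2)[OF lim nonneg mono, of 0]
    by (simp add: consecutive_pierce_def)
qed

text \<open>Splitting off the first term of the series gives \<open>y k = 1 / k - y (k + 1) / k\<close>. The right-hand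
  side of the lemma is the Pierce map at \<open>y k\<close>, once the first digit is known to be \<open>k\<close>.\<close>

lemma consecutive_pierce_Suc:
  assumes "1 \<le> k"
  shows "consecutive_pierce (Suc k) = 1 - real k * consecutive_pierce k"
proof -
  let ?f = "\<lambda>j. (-1) ^ j * (1 / pochhammer (real k) (Suc j))"
  let ?g = "\<lambda>j. (-1) ^ j * (1 / pochhammer (real (Suc k)) (Suc j))"
  have k: "real k \<noteq> 0" using assms by simp
  have "?f (Suc j) = - (1 / real k) * ?g j" for j
    by (subst pochhammer_rec) (simp add: add.commute)
  then have "(\<Sum>j. ?f (Suc j)) = - (1 / real k) * consecutive_pierce (Suc k)"
    unfolding consecutive_pierce_def
    using suminf_mult[OF summable_consecutive_pierce[of "Suc k"], of "- (1 / real k)"] by simp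
  moreover have "(\<Sum>j. ?f (Suc j)) = consecutive_pierce k - 1 / real k"
    using suminf_split_head[OF summable_consecutive_pierce[OF assms]]
    by (simp add: consecutive_pierce_def)
  ultimately show ?thesis using k by (simp add: field_simps)
qed

text \<open>These bounds say that the first digit is \<open>k\<close>. They come from nonnegativity alone, by feeding
  each estimate back into \<open>y k = (1 - y (k + 1)) / k\<close>: nonnegativity of all \<open>y i\<close> gives
  \<open>y i \<le> 1 / i\<close>, this makes all \<open>y i\<close> positive, positivity makes the upper bound strict, and the
  strict upper bound at \<open>k + 1\<close> is the lower bound at \<open>k\<close>.\<close>

lemma consecutive_pierce_bounds:
  assumes "1 \<le> k"
  shows "1 / real (Suc k) < consecutive_pierce k" and "consecutive_pierce k < 1 / real k"
proof -
  let ?y = consecutive_pierce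
  have eq: "?y i = (1 - ?y (Suc i)) / real i" if "1 \<le> i" for i
    using consecutive_pierce_Suc[OF that] that by (simp add: field_simps)
  have le: "?y i \<le> 1 / real i" if "1 \<le> i" for i
    using consecutive_pierce_nonneg[of "Suc i"] that
    by (subst eq) (auto intro!: divide_right_mono)
  have pos: "0 < ?y i" if "1 \<le> i" for i
  proof -
    have "1 / real (Suc i) < 1" using that by simp
    then have "?y (Suc i) < 1" using le[of "Suc i"] by linarith
    then show ?thesis using that by (subst eq) simp_all
  qed
  have less: "?y i < 1 / real i" if "1 \<le> i" for i
    using pos[of "Suc i"] that
    by (subst eq) (auto intro!: divide_strict_right_mono)
  show "?y k < 1 / real k" by (rule less[OF assms])
  have "1 / real (Suc k) = (1 - 1 / real (Suc k)) / real k"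
  proof -
    have "1 - 1 / real (Suc k) = real k / real (Suc k)" by (simp add: field_simps)
    then show ?thesis using assms by simp
  qed
  also have "\<dots> < (1 - ?y (Suc k)) / real k"
    using less[of "Suc k"] assms by (intro divide_strict_right_mono) simp_all
  also have "\<dots> = ?y k" using eq[OF assms] by simp
  finally show "1 / real (Suc k) < ?y k" .
qed

lemma consecutive_pierce_pos: "1 \<le> k \<Longrightarrow> 0 < consecutive_pierce k"
  using consecutive_pierce_bounds(1)[of k] by (smt (verit) of_nat_0_le_iff divide_nonneg_nonneg)

lemma floor_inverse_eq:
  fixes x :: real
  assumes "1 \<le> k" and "1 / real (Suc k) < x" and "x \<le> 1 / real k"
  shows "\<lfloor>1 / x\<rfloor> = int k"
proof -
  have x: "0 < x" using assms(2) by (smt (verit) of_nat_0_le_iff divide_nonneg_nonneg)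
  show ?thesis
    using assms x by (intro floor_unique) (simp_all add: field_simps)
qed

lemma funpow_pierce_T_consecutive:
  assumes "1 \<le> k"
  shows "(pierce_T ^^ n) (consecutive_pierce k) = consecutive_pierce (k + n)"
proof (induction n)
  case (Suc n)
  let ?y = "consecutive_pierce (k + n)"
  have kn: "1 \<le> k + n" using assms by simp
  have "\<lfloor>1 / ?y\<rfloor> = int (k + n)"
    using consecutive_pierce_bounds[OF kn] kn by (intro floor_inverse_eq) simp_all
  then show ?case
    using Suc consecutive_pierce_pos[OF kn] consecutive_pierce_Suc[OF kn]
    by (simp add: pierce_T_def)
qed simp

lemma pierce_digit_consecutive:
  assumes "1 \<le> k"
  shows "pierce_digit (Suc n) (consecutive_pierce k) = enat (k + n)"
proof -
  let ?y = "consecutive_pierce (k + n)"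
  have kn: "1 \<le> k + n" using assms by simp
  have "\<lfloor>1 / ?y\<rfloor> = int (k + n)"
    using consecutive_pierce_bounds[OF kn] kn by (intro floor_inverse_eq) simp_all
  then show ?thesis
    using consecutive_pierce_pos[OF kn]
    by (simp add: pierce_digit_def funpow_pierce_T_consecutive[OF assms] pierce_d1_def nat_int_add)
qed

lemma consecutive_pierce_in_D_div:
  assumes "0 < s" and "s \<le> 1" and "1 \<le> k"
  shows "consecutive_pierce k \<in> D_div s"
proof -
  have "\<not> summable (\<lambda>n. 1 / real (k + n) powr s)"
  proof
    assume "summable (\<lambda>n. 1 / real (k + n) powr s)"
    moreover have "norm (inverse (real (n + k))) \<le> 1 / real (k + n) powr s" for n
    proof -
      have "real (k + n) powr s \<le> real (k + n) powr 1"
        using assms by (intro powr_mono) simp_all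
      then have "1 / real (k + n) \<le> 1 / real (k + n) powr s"
        using assms by (intro frac_le) simp_all
      then show ?thesis by (simp add: field_simps)
    qed
    ultimately have "summable (\<lambda>n. inverse (real (n + k)))"
      by (rule summable_comparison_test'[where N = 0])
    then have "summable (\<lambda>n. inverse (real n))"
      by (subst (asm) summable_iff_shift[where f = "\<lambda>n. inverse (real n)"])
    then show False using not_summable_harmonic by blast
  qed
  moreover have "real_of_ereal (1 / digit_powr (pierce_digit (Suc n) (consecutive_pierce k)) s)
      = 1 / real (k + n) powr s" for n
    using assms by (simp add: pierce_digit_consecutive digit_powr_def one_ereal_def)
  moreover have "1 / real k \<le> 1" using assms(3) by simp
  then have "0 \<le> consecutive_pierce k" "consecutive_pierce k \<le> 1"
    using consecutive_pierce_pos[OF assms(3)] consecutive_pierce_bounds(2)[OF assms(3)]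
    by linarith+
  ultimately show ?thesis by (simp add: D_div_def)
qed

section \<open>Density of the divergence set\<close>

text \<open>Applying the Pierce map drops the first digit, which does not affect divergence.\<close>

lemma D_div_pierce_T:
  assumes "x \<in> {0..1}" and "pierce_T x \<in> D_div s"
  shows "x \<in> D_div s"
proof -
  let ?t = "\<lambda>x n. real_of_ereal (1 / digit_powr (pierce_digit (Suc n) x) s)"
  have "?t x (Suc n) = ?t (pierce_T x) n" for n
    by (simp add: pierce_digit_def funpow_swap1)
  then have "summable (?t x) \<longleftrightarrow> summable (?t (pierce_T x))"
    using summable_Suc_iff[of "?t x"] by simp
  then show ?thesis using assms by (simp add: D_div_def)
qed

text \<open>The condition \<open>y < 1 / (k + 1)\<close> is what makes \<open>k\<close> the first digit of \<open>(1 - y) / k\<close>, so that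
  the Pierce map takes this point back to \<open>y\<close>.\<close>

lemma D_div_inverse_branch:
  assumes "1 \<le> k" and "y \<in> D_div s" and "y < 1 / real (Suc k)"
  shows "(1 - y) / real k \<in> D_div s"
proof (rule D_div_pierce_T)
  let ?x = "(1 - y) / real k"
  have y: "0 \<le> y" using assms(2) by (simp add: D_div_def)
  have k: "0 < real k" using assms(1) by simp
  have gt: "1 / real (Suc k) < ?x" using assms(3) k by (simp add: field_simps)
  have le: "?x \<le> 1 / real k" using y k by (intro divide_right_mono) simp_all
  have "1 / real k \<le> 1" using assms(1) by simp
  moreover have pos: "0 < ?x" using gt by (smt (verit) of_nat_0_le_iff divide_nonneg_nonneg)
  ultimately show "?x \<in> {0..1}" using le by simp
  have "\<lfloor>1 / ?x\<rfloor> = int k" using floor_inverse_eq[OF assms(1) gt le] .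
  then have "pierce_T ?x = 1 - real k * ?x"
    using pos unfolding pierce_T_def by (metis less_irrefl of_int_of_nat_eq)
  then have "pierce_T ?x = y" using k by simp
  then show "pierce_T ?x \<in> D_div s" using assms(2) by simp
qed

text \<open>The Pierce map tends to \<open>0\<close> at \<open>1 / k\<close> from the left. Pulling back the points with consecutive
  digits, which accumulate at \<open>0\<close>, shows that every discontinuity of the Pierce map is a limit of
  points of the divergence set.\<close>

lemma D_div_left_of_inverse:
  assumes s: "0 < s" "s \<le> 1" and k: "1 \<le> k" and a: "a < 1 / real k"
  shows "\<exists>x \<in> D_div s. a < x \<and> x < 1 / real k"
proof -
  have "0 < 1 - real k * a" using a k by (simp add: field_simps)
  then obtain n where n: "inverse (real (Suc n)) < 1 - real k * a"
    using reals_Archimedean by blast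
  \<comment> \<open>One index large enough for both requirements: beyond \<open>a\<close>, and with first digit \<open>k\<close>.\<close>
  define m where "m = Suc (n + k)"
  have m: "1 \<le> m" by (simp add: m_def)
  let ?y = "consecutive_pierce m"
  have y: "0 < ?y" "?y < 1 / real m"
    using consecutive_pierce_pos[OF m] consecutive_pierce_bounds(2)[OF m] by auto
  have "1 / real m \<le> inverse (real (Suc n))" "1 / real m \<le> 1 / real (Suc k)"
    unfolding inverse_eq_divide m_def by (intro frac_le; simp)+
  then have "?y < 1 - real k * a" "?y < 1 / real (Suc k)" using y n by linarith+
  moreover have "?y \<in> D_div s" by (rule consecutive_pierce_in_D_div[OF s m])
  ultimately show ?thesis
    using D_div_inverse_branch[OF k, of ?y s] y k
    by (intro bexI[of _ "(1 - ?y) / real k"]) (simp_all add: field_simps)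
qed

text \<open>A gap of the divergence set contains no discontinuity of the Pierce map, hence the map is affine
  with slope \<open>- k\<close> there; the image is a gap \<open>k\<close> times as long. The bound on the upper end of the
  image keeps it inside \<open>[0, 1/2]\<close>, where the step can be repeated with \<open>k \<ge> 2\<close>.\<close>

lemma D_div_gap_expands:
  assumes s: "0 < s" "s \<le> 1"
    and ab: "0 \<le> a" "a < b" "b \<le> 1" and gap: "D_div s \<inter> {a<..<b} = {}"
  obtains k where "1 \<le> k" "0 \<le> 1 - real k * b" "1 - real k * a \<le> 1 / real (Suc k)"
    "D_div s \<inter> {1 - real k * b <..< 1 - real k * a} = {}"
proof -
  have no_inverse: "\<not> (a < 1 / real k \<and> 1 / real k \<le> b)" if "1 \<le> k" for k
    using D_div_left_of_inverse[OF s that] gap by fastforce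
  define k where "k = nat \<lfloor>1 / b\<rfloor>"
  have b: "0 < b" using ab by simp
  have "1 \<le> 1 / b" using b ab by simp
  then have fl: "1 \<le> \<lfloor>1 / b\<rfloor>" by simp
  then have k: "1 \<le> k" unfolding k_def by linarith
  have rk: "real k = of_int \<lfloor>1 / b\<rfloor>"
    unfolding k_def by (rule of_nat_nat) (use fl in linarith)
  have "real k \<le> 1 / b" "1 / b < real k + 1" unfolding rk by linarith+
  then have kb: "real k * b \<le> 1" "1 < real (Suc k) * b" using b by (simp_all add: field_simps)
  then have gt: "1 / real (Suc k) < b" by (simp add: field_simps)
  have ak: "1 / real (Suc k) \<le> a" using no_inverse[of "Suc k"] gt by force
  have eq: "1 - real k * (1 / real (Suc k)) = 1 / real (Suc k)" by (simp add: field_simps)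
  have ka: "1 - real k * a \<le> 1 / real (Suc k)"
    using mult_left_mono[OF ak, of "real k"] eq by linarith
  have "D_div s \<inter> {1 - real k * b <..< 1 - real k * a} = {}"
  proof (intro equals0I)
    fix y assume "y \<in> D_div s \<inter> {1 - real k * b <..< 1 - real k * a}"
    then have y: "y \<in> D_div s" "1 - real k * b < y" "y < 1 - real k * a" by auto
    then have "(1 - y) / real k \<in> D_div s" using ka by (intro D_div_inverse_branch[OF k]) auto
    moreover have "a < (1 - y) / real k" "(1 - y) / real k < b"
      using y k by (simp_all add: field_simps)
    ultimately show False using gap by auto
  qed
  then show thesis using that[OF k _ ka] kb by simp
qed

text \<open>The first digit of a point of \<open>(0, 1/2]\<close> is at least \<open>2\<close>, so every step at least doubles the
  length of a gap. The induction counts the doublings that would make the length reach \<open>1\<close>.\<close>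

lemma D_div_meets_small_interval:
  assumes s: "0 < s" "s \<le> 1"
  shows "0 \<le> a \<Longrightarrow> a < b \<Longrightarrow> b \<le> 1 / 2 \<Longrightarrow> 1 \<le> 2 ^ n * (b - a) \<Longrightarrow> D_div s \<inter> {a<..<b} \<noteq> {}"
proof (induction n arbitrary: a b)
  case 0
  then show ?case by simp
next
  case (Suc n)
  show ?case
  proof
    assume gap: "D_div s \<inter> {a<..<b} = {}"
    have b1: "b \<le> 1" using Suc.prems by simp
    obtain k where k: "1 \<le> k" "0 \<le> 1 - real k * b" "1 - real k * a \<le> 1 / real (Suc k)"
      "D_div s \<inter> {1 - real k * b <..< 1 - real k * a} = {}"
      using D_div_gap_expands[OF s Suc.prems(1,2) b1 gap] by metis
    have "k \<noteq> 1"
    proof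
      assume "k = 1"
      then have "1 / 2 \<le> a" using k(3) by simp
      then show False using Suc.prems by simp
    qed
    then have k2: "2 \<le> real k" using k(1) by simp
    have "1 / real (Suc k) \<le> 1 / 2" using k(1) by (intro frac_le) simp_all
    then have "1 - real k * a \<le> 1 / 2" using k(3) by linarith
    moreover have "1 - real k * b < 1 - real k * a" using Suc.prems(2) k(1) by simp
    moreover have "1 \<le> 2 ^ n * ((1 - real k * a) - (1 - real k * b))"
    proof -
      have "1 \<le> 2 ^ n * (2 * (b - a))" using Suc.prems(4) by (simp only: power_Suc mult.assoc mult.left_commute)
      also have "\<dots> \<le> 2 ^ n * (real k * (b - a))"
        using k2 Suc.prems(2) by (intro mult_left_mono mult_right_mono) simp_all
      finally show ?thesis by (simp add: algebra_simps)
    qed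
    ultimately show False using Suc.IH[OF k(2)] k(4) by blast
  qed
qed

text \<open>The branch with digit \<open>1\<close> preserves lengths, but it takes \<open>(1/2, 1]\<close> to \<open>[0, 1/2)\<close>: after one
  step the previous lemma applies.\<close>

lemma D_div_meets_interval:
  assumes s: "0 < s" "s \<le> 1" and ab: "0 \<le> a" "a < b" "b \<le> 1"
  shows "D_div s \<inter> {a<..<b} \<noteq> {}"
proof
  have small: "D_div s \<inter> {c<..<d} \<noteq> {}" if "0 \<le> c" "c < d" "d \<le> 1 / 2" for c d
  proof -
    obtain n where "1 / (d - c) < 2 ^ n" using real_arch_pow[of 2 "1 / (d - c)"] by auto
    then have "1 \<le> 2 ^ n * (d - c)" using that by (simp add: field_simps)
    then show ?thesis using D_div_meets_small_interval[OF s that] by blast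
  qed
  assume "D_div s \<inter> {a<..<b} = {}"
  then obtain k where k: "1 \<le> k" "0 \<le> 1 - real k * b" "1 - real k * a \<le> 1 / real (Suc k)"
      "D_div s \<inter> {1 - real k * b <..< 1 - real k * a} = {}"
    using D_div_gap_expands[OF s ab] by metis
  have "1 / real (Suc k) \<le> 1 / 2" using k(1) by (intro frac_le) simp_all
  then have "1 - real k * a \<le> 1 / 2" using k(3) by linarith
  then show False using small[OF k(2) _ _] k(1,4) ab(2) by simp
qed

lemma closure_D_div:
  assumes s: "0 < s" "s \<le> 1"
  shows "{0..1} \<subseteq> closure (D_div s)"
proof -
  have "{0<..<1} \<subseteq> closure (D_div s)"
  proof
    fix x :: real assume x: "x \<in> {0<..<1}"
    show "x \<in> closure (D_div s)"
      unfolding closure_approachable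
    proof (intro allI impI)
      fix e :: real assume e: "0 < e"
      have "D_div s \<inter> {x<..<min 1 (x + e)} \<noteq> {}"
        using x e by (intro D_div_meets_interval[OF s]) auto
      then obtain y where "y \<in> D_div s" "y \<in> {x<..<min 1 (x + e)}" by blast
      then show "\<exists>y\<in>D_div s. dist y x < e" by (intro bexI[of _ y]) (auto simp: dist_real_def)
    qed
  qed
  then have "closure {0<..<1} \<subseteq> closure (D_div s)" by (intro closure_minimal) simp_all
  then show ?thesis by simp
qed

section \<open>Box dimension of dense subsets of the unit interval\<close>

lemma ex_diam_cover_unit_interval:
  assumes "0 < \<delta>" and "F \<subseteq> {0..1}"
  shows "\<exists>\<U>. is_diam_cover \<delta> F \<U> \<and> real (card \<U>) \<le> 1 / \<delta> + 1"
proof -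
  let ?I = "\<lambda>i::nat. {real i * \<delta> .. real (Suc i) * \<delta>}"
  define m where "m = nat \<lfloor>1 / \<delta>\<rfloor>"
  let ?U = "?I ` {..m}"
  have rm: "real m = of_int \<lfloor>1 / \<delta>\<rfloor>" using assms(1) by (simp add: m_def)
  have "F \<subseteq> \<Union>?U"
  proof
    fix x assume "x \<in> F"
    then have x: "0 \<le> x" "x \<le> 1" using assms by auto
    define i where "i = nat \<lfloor>x / \<delta>\<rfloor>"
    have ri: "real i = of_int \<lfloor>x / \<delta>\<rfloor>" using x assms(1) by (simp add: i_def)
    have "x / \<delta> \<le> 1 / \<delta>" using x assms(1) by (intro divide_right_mono) simp_all
    then have "i \<le> m" unfolding i_def m_def by (intro nat_mono floor_mono)
    moreover have "real i \<le> x / \<delta>" "x / \<delta> \<le> real (Suc i)" using ri by simp_all linarith+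
    then have "x \<in> ?I i" using assms(1) by (simp add: field_simps)
    ultimately show "x \<in> \<Union>?U" by blast
  qed
  moreover have "bounded (?I i) \<and> diameter (?I i) \<le> \<delta>" for i
    using assms(1) by (simp add: algebra_simps)
  ultimately have "is_diam_cover \<delta> F ?U" by (auto simp: is_diam_cover_def)
  moreover have "card ?U \<le> Suc m" using card_image_le[of "{..m}" ?I] by simp
  then have "real (card ?U) \<le> real m + 1" by linarith
  then have "real (card ?U) \<le> 1 / \<delta> + 1" unfolding rm by linarith
  ultimately show ?thesis by blast
qed

text \<open>A finite union of closed balls is closed, so it contains \<open>[0,1]\<close> once it contains \<open>F\<close>; comparing
  lengths gives the bound. Balls about chosen points cost a factor \<open>2\<close> over the optimal \<open>1 / \<delta>\<close>,
  which disappears in the limit of the logarithms.\<close>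

lemma card_diam_cover_ge:
  assumes "0 < \<delta>" and dense: "{0..1} \<subseteq> closure F" and U: "is_diam_cover \<delta> F \<U>"
  shows "1 / (2 * \<delta>) \<le> real (card \<U>)"
proof -
  define c where "c U = (SOME x. x \<in> U)" for U :: "real set"
  have fin: "finite \<U>" using U by (simp add: is_diam_cover_def)
  have "F \<subseteq> (\<Union>U\<in>\<U>. cball (c U) \<delta>)"
  proof
    fix x assume "x \<in> F"
    then obtain A where A: "A \<in> \<U>" "x \<in> A" "bounded A" "diameter A \<le> \<delta>"
      using U by (auto simp: is_diam_cover_def)
    have "c A \<in> A" unfolding c_def using A(2) by (rule someI)
    then have "dist (c A) x \<le> \<delta>" using diameter_bounded_bound[OF A(3) _ A(2)] A(4) by fastforce
    then show "x \<in> (\<Union>U\<in>\<U>. cball (c U) \<delta>)" using A(1) by auto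
  qed
  moreover have "closed (\<Union>U\<in>\<U>. cball (c U) \<delta>)" using fin by (intro closed_UN) auto
  ultimately have sub: "{0..1} \<subseteq> (\<Union>U\<in>\<U>. cball (c U) \<delta>)"
    using dense closure_minimal by blast
  have "1 = measure lborel {0..1::real}" by simp
  also have "\<dots> \<le> measure lborel (\<Union>U\<in>\<U>. cball (c U) \<delta>)"
    using sub fin by (intro measure_mono_fmeasurable fmeasurable.finite_UN fmeasurableI)
      (use assms(1) in \<open>auto simp: cball_eq_atLeastAtMost ennreal_less_top\<close>)
  also have "\<dots> \<le> (\<Sum>U\<in>\<U>. measure lborel (cball (c U) \<delta>))"
    using fin by (intro measure_UNION_le) auto
  also have "\<dots> = real (card \<U>) * (2 * \<delta>)"
    using assms(1) by (simp add: cball_eq_atLeastAtMost)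
  finally show ?thesis using assms(1) by (simp add: field_simps)
qed

lemma covering_number_dense_bounds:
  assumes "0 < \<delta>" and F: "F \<subseteq> {0..1}" and dense: "{0..1} \<subseteq> closure F"
  shows "1 / (2 * \<delta>) \<le> real (covering_number \<delta> F)"
    and "real (covering_number \<delta> F) \<le> 1 / \<delta> + 1"
proof -
  let ?P = "\<lambda>k. \<exists>\<U>. is_diam_cover \<delta> F \<U> \<and> card \<U> = k"
  obtain \<U> where U: "is_diam_cover \<delta> F \<U>" "real (card \<U>) \<le> 1 / \<delta> + 1"
    using ex_diam_cover_unit_interval[OF assms(1) F] by blast
  have P: "?P (card \<U>)" using U(1) by blast
  have "?P (covering_number \<delta> F)" unfolding covering_number_def using P by (rule LeastI)
  then show "1 / (2 * \<delta>) \<le> real (covering_number \<delta> F)"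
    using card_diam_cover_ge[OF assms(1) dense] by metis
  have "covering_number \<delta> F \<le> card \<U>" unfolding covering_number_def using P by (rule Least_le)
  then show "real (covering_number \<delta> F) \<le> 1 / \<delta> + 1" using U(2) by linarith
qed

lemma has_box_dimension_dense:
  assumes F: "F \<subseteq> {0..1}" and dense: "{0..1} \<subseteq> closure F"
  shows "has_box_dimension F 1"
proof -
  let ?N = "\<lambda>\<delta>. real (covering_number \<delta> F)"
  have "((\<lambda>\<delta>. ln (?N \<delta>) / (- ln \<delta>)) \<longlongrightarrow> 1) (at_right 0)"
  proof (rule tendsto_sandwich)
    have small: "\<forall>\<^sub>F \<delta> in at_right (0::real). \<delta> \<in> {0<..<1}"
      by (rule eventually_at_right_real) simp
    show "\<forall>\<^sub>F \<delta> in at_right 0. ln (1 / (2 * \<delta>)) / (- ln \<delta>) \<le> ln (?N \<delta>) / (- ln \<delta>)"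
      using small
    proof eventually_elim
      case (elim \<delta>)
      then have d: "0 < \<delta>" "\<delta> < 1" by auto
      have "0 < 1 / (2 * \<delta>)" using d by simp
      then show ?case using covering_number_dense_bounds(1)[OF d(1) F dense] d
        by (intro divide_right_mono ln_mono) auto
    qed
    show "\<forall>\<^sub>F \<delta> in at_right 0. ln (?N \<delta>) / (- ln \<delta>) \<le> ln (1 / \<delta> + 1) / (- ln \<delta>)"
      using small
    proof eventually_elim
      case (elim \<delta>)
      then have d: "0 < \<delta>" "\<delta> < 1" by auto
      have "0 < 1 / (2 * \<delta>)" using d by simp
      then have "0 < ?N \<delta>" using covering_number_dense_bounds(1)[OF d(1) F dense] by linarith
      then show ?case using covering_number_dense_bounds(2)[OF d(1) F dense] d
        by (intro divide_right_mono ln_mono) auto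
    qed
    show "((\<lambda>\<delta>::real. ln (1 / (2 * \<delta>)) / (- ln \<delta>)) \<longlongrightarrow> 1) (at_right 0)" by real_asymp
    show "((\<lambda>\<delta>::real. ln (1 / \<delta> + 1) / (- ln \<delta>)) \<longlongrightarrow> 1) (at_right 0)" by real_asymp
  qed
  moreover have "F \<noteq> {}" using dense by auto
  ultimately show ?thesis using F by (simp add: has_box_dimension_def)
qed

theorem corollary1p14:
  fixes s :: real
  assumes "0 < s" and "s \<le> 1"
  shows "has_box_dimension (D_div s) 1"
proof (rule has_box_dimension_dense)
  show "D_div s \<subseteq> {0..1}" by (auto simp: D_div_def)
  show "{0..1} \<subseteq> closure (D_div s)" by (rule closure_D_div[OF assms])
qed

end
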